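(* Let $(X,\odot,\ell,r)$ be an $\ell r$-multimagma in which there exist $x,y,z,w\in X$ (not necessarily distinct) such that $\ell(x)\odot\ell(y)\neq\emptyset$ and $z\odot w\neq\emptyset$. Let $(Q,\le,\cdot,1)$ be a prequantale with maps $\textit{dom},\textit{cod}:Q\to Q$, and suppose that $(Q^X,\le,\ast,\textit{id}_E,\textit{Dom},\textit{Cod})$ is a modal prequantale with $\textit{id}_E\neq\bot$. \begin{enumerate} \item Then $(Q,\le,\cdot,1,\textit{dom},\textit{cod})$ is a modal prequantale. \item If moreover $X$ is an $\ell r$-multisemigroup and $(Q^X,\le,\ast,\textit{id}_E,\textit{Dom},\textit{Cod})$ is a weakly local modal quantale, then $Q$ is a weakly local modal quantale. \item If moreover $X$ is a local $\ell r$-multisemigroup and $(Q^X,\le,\ast,\textit{id}_E,\textit{Dom},\textit{Cod})$ is a modal quantale, then $Q$ is a modal quantale. \end{enumerate}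
   Context: A multimagma is a non-empty set $X$ with $\odot:X\times X\to\mathcal{P}X$; for $A,B\subseteq X$, $A\odot B=\bigcup\{a\odot b\mid a\in A,b\in B\}$; $D_{xy}$ means $x\odot y\neq\emptyset$. An $\ell r$-multimagma is a multimagma with maps $\ell,r:X\to X$ such that $D_{xy}\Rightarrow r(x)=\ell(y)$, $\ell(x)\odot x=\{x\}$, $x\odot r(x)=\{x\}$ for all $x,y$. An $\ell r$-multisemigroup is an $\ell r$-multimagma with $x\odot(y\odot z)=(x\odot y)\odot z$ for all $x,y,z$; it is local if $r(x)=\ell(y)\Rightarrow D_{xy}$. $E=\{x\in X\mid\ell(x)=x\}$. A prequantale $(Q,\le,\cdot,1)$ is a complete lattice with a binary operation $\cdot$ with two-sided unit $1$ preserving arbitrary sups in each argument; $\bot$ least element. A modal prequantale: prequantale with $\textit{dom},\textit{cod}$ such that $\alpha\le\textit{dom}(\alpha)\cdot\alpha$, $\textit{dom}(\textit{dom}(\alpha)\cdot\beta)=\textit{dom}(\alpha)\cdot\textit{dom}(\beta)$, $\textit{dom}(\alpha)\le1$, $\textit{dom}(\bot)=\bot$, $\textit{dom}(\alpha\vee\beta)=\textit{dom}(\alpha)\vee\textit{dom}(\beta)$, the opposite axioms for $\textit{cod}$ (with arguments of $\cdot$ swapped, e.g. $\textit{cod}(\alpha\cdot\textit{cod}(\beta))=\textit{cod}(\alpha)\cdot\textit{cod}(\beta)$), and $\textit{dom}\circ\textit{cod}=\textit{cod}$, $\textit{cod}\circ\textit{dom}=\textit{dom}$. A weakly local modal quantale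 is a modal prequantale with associative $\cdot$. A modal quantale is a prequantale with associative $\cdot$ and $\textit{dom},\textit{cod}$ satisfying the same axioms but with the export axioms replaced by locality: $\textit{dom}(\alpha\cdot\textit{dom}(\beta))=\textit{dom}(\alpha\cdot\beta)$, $\textit{cod}(\textit{cod}(\alpha)\cdot\beta)=\textit{cod}(\alpha\cdot\beta)$. On $Q^X$: pointwise order; $(f\ast g)(x)=\bigvee\{f(y)\cdot g(z)\mid x\in y\odot z\}$; $\textit{id}_E(x)=1$ if $x\in E$, else $\bot$; $\textit{Dom}(f)(y)=\bigvee\{\textit{dom}(f(x))\mid\ell(x)=y\}$; $\textit{Cod}(f)(y)=\bigvee\{\textit{cod}(f(x))\mid r(x)=y\}$. *)

theory Defs
  imports Main
begin

text \<open>
  The non-empty set X is the universe of a type. The complete lattice Q is a type of class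
  \<^class>\<open>complete_lattice\<close>, so that the function type from X to Q is again a
  complete lattice, with the pointwise order.
\<close>

definition lift_mult :: "('x \<Rightarrow> 'x \<Rightarrow> 'x set) \<Rightarrow> 'x set \<Rightarrow> 'x set \<Rightarrow> 'x set" where
  "lift_mult m A B = (\<Union>a\<in>A. \<Union>b\<in>B. m a b)"

definition composable :: "('x \<Rightarrow> 'x \<Rightarrow> 'x set) \<Rightarrow> 'x \<Rightarrow> 'x \<Rightarrow> bool" where
  "composable m x y \<longleftrightarrow> m x y \<noteq> {}"

locale lr_multimagma =
  fixes m :: "'x \<Rightarrow> 'x \<Rightarrow> 'x set"  (infixl "\<odot>" 70)
    and l :: "'x \<Rightarrow> 'x"
    and r :: "'x \<Rightarrow> 'x"
  assumes composable_imp: "composable m x y \<Longrightarrow> r x = l y"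
    and left_unit: "l x \<odot> x = {x}"
    and right_unit: "x \<odot> r x = {x}"

locale lr_multisemigroup = lr_multimagma +
  assumes multi_assoc: "lift_mult m {x} (y \<odot> z) = lift_mult m (x \<odot> y) {z}"

locale local_lr_multisemigroup = lr_multisemigroup +
  assumes multi_local: "r x = l y \<Longrightarrow> composable m x y"

definition lr_units :: "('x \<Rightarrow> 'x) \<Rightarrow> 'x set" where
  "lr_units l = {x. l x = x}"

locale prequantale =
  fixes mult :: "'q::complete_lattice \<Rightarrow> 'q \<Rightarrow> 'q"  (infixl "\<cdot>" 70)
    and one :: "'q"
  assumes mult_one_left: "one \<cdot> a = a"
    and mult_one_right: "a \<cdot> one = a"
    and mult_Sup_left: "Sup A \<cdot> b = (SUP a\<in>A. a \<cdot> b)"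
    and mult_Sup_right: "a \<cdot> Sup B = (SUP b\<in>B. a \<cdot> b)"

text \<open>The axioms shared by modal prequantales (which add export) and modal quantales
  (which add associativity and locality).\<close>

locale dom_cod_prequantale = prequantale mult one
  for mult :: "'q::complete_lattice \<Rightarrow> 'q \<Rightarrow> 'q"  (infixl "\<cdot>" 70)
    and one :: "'q" +
  fixes dom :: "'q \<Rightarrow> 'q"
    and cod :: "'q \<Rightarrow> 'q"
  assumes dom_absorb: "a \<le> dom a \<cdot> a"
    and dom_le_one: "dom a \<le> one"
    and dom_bot: "dom bot = bot"
    and dom_sup: "dom (sup a b) = sup (dom a) (dom b)"
    and cod_absorb: "a \<le> a \<cdot> cod a"
    and cod_le_one: "cod a \<le> one"
    and cod_bot: "cod bot = bot"
    and cod_sup: "cod (sup a b) = sup (cod a) (cod b)"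
    and dom_cod: "dom (cod a) = cod a"
    and cod_dom: "cod (dom a) = dom a"

locale modal_prequantale = dom_cod_prequantale +
  assumes dom_export: "dom (dom a \<cdot> b) = dom a \<cdot> dom b"
    and cod_export: "cod (a \<cdot> cod b) = cod a \<cdot> cod b"

locale weakly_local_modal_quantale = modal_prequantale +
  assumes mult_assoc: "(a \<cdot> b) \<cdot> c = a \<cdot> (b \<cdot> c)"

locale modal_quantale = dom_cod_prequantale +
  assumes mult_assoc: "(a \<cdot> b) \<cdot> c = a \<cdot> (b \<cdot> c)"
    and dom_local: "dom (a \<cdot> dom b) = dom (a \<cdot> b)"
    and cod_local: "cod (cod a \<cdot> b) = cod (a \<cdot> b)"

definition convolution ::
    "('x \<Rightarrow> 'x \<Rightarrow> 'x set) \<Rightarrow> ('q::complete_lattice \<Rightarrow> 'q \<Rightarrow> 'q)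
      \<Rightarrow> ('x \<Rightarrow> 'q) \<Rightarrow> ('x \<Rightarrow> 'q) \<Rightarrow> 'x \<Rightarrow> 'q" where
  "convolution m mult f g x = Sup {mult (f y) (g z) | y z. x \<in> m y z}"

definition id_E :: "('x \<Rightarrow> 'x) \<Rightarrow> 'q::complete_lattice \<Rightarrow> 'x \<Rightarrow> 'q" where
  "id_E l one x = (if x \<in> lr_units l then one else bot)"

definition Dom ::
    "('x \<Rightarrow> 'x) \<Rightarrow> ('q::complete_lattice \<Rightarrow> 'q) \<Rightarrow> ('x \<Rightarrow> 'q) \<Rightarrow> 'x \<Rightarrow> 'q" where
  "Dom l d f y = Sup {d (f x) | x. l x = y}"

definition Cod ::
    "('x \<Rightarrow> 'x) \<Rightarrow> ('q::complete_lattice \<Rightarrow> 'q) \<Rightarrow> ('x \<Rightarrow> 'q) \<Rightarrow> 'x \<Rightarrow> 'q" where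
  "Cod r c f y = Sup {c (f x) | x. r x = y}"

end

theory Submission
  imports Defs
begin

text \<open>
  Fix any x and put \<open>e = l x\<close>. Then \<open>l e = r e = e\<close> and \<open>e \<odot> e = {e}\<close>, so the map sending
  \<open>a\<close> to the function with value \<open>a\<close> at \<open>e\<close> and \<open>\<bottom>\<close> elsewhere is an order embedding of Q
  into Q^X that commutes with composition, domain, codomain and suprema. It reflects all
  axioms, each of which is an (in)equation between such operations. The unit of Q is not mapped to
  \<open>id_E\<close>, but it is the value of \<open>id_E\<close> at \<open>e\<close>, which is all that \<open>dom a \<le> 1\<close> needs.
\<close>

text \<open>The product \<open>l x \<odot> x\<close> contains \<open>x\<close>, so
  \<open>l x\<close> and \<open>x\<close> are composable and \<open>composable_imp\<close>
  applies.\<close>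

lemma (in lr_multimagma) r_l: "r (l x) = l x"
  using composable_imp[of "l x" x] left_unit[of x] by (simp add: composable_def)

lemma (in lr_multimagma) l_idem_mult: "l x \<odot> l x = {l x}"
  using right_unit[of "l x"] by (simp add: r_l)

lemma (in lr_multimagma) l_l: "l (l x) = l x"
  using composable_imp[of "l x" "l x"] l_idem_mult[of x] by (simp add: composable_def r_l)

lemma (in prequantale) mult_bot_left: "bot \<cdot> b = bot"
  using mult_Sup_left[of "{}" b] by simp

lemma (in prequantale) mult_bot_right: "a \<cdot> bot = bot"
  using mult_Sup_right[of a "{}"] by simp

text \<open>The unit is only required to be reflected as an upper bound, since \<open>h one\<close> and \<open>one'\<close>
  differ in the application.\<close>

locale modal_embedding = prequantale mult one
  for mult :: "'q::complete_lattice \<Rightarrow> 'q \<Rightarrow> 'q"  (infixl "\<cdot>" 70)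
    and one :: "'q"
    and dom cod :: "'q \<Rightarrow> 'q"
    and mult' :: "'p::complete_lattice \<Rightarrow> 'p \<Rightarrow> 'p"  (infixl "\<star>" 70)
    and one' :: "'p"
    and dom' cod' :: "'p \<Rightarrow> 'p"
    and h :: "'q \<Rightarrow> 'p" +
  assumes le_iff: "h a \<le> h b \<longleftrightarrow> a \<le> b"
    and le_one: "h a \<le> one' \<Longrightarrow> a \<le> one"
    and hom_bot: "h bot = bot"
    and hom_sup: "h (sup a b) = sup (h a) (h b)"
    and hom_mult: "h (a \<cdot> b) = h a \<star> h b"
    and hom_dom: "h (dom a) = dom' (h a)"
    and hom_cod: "h (cod a) = cod' (h a)"
begin

text \<open>Used as a rewrite rule, this moves an equation of \<open>'q\<close> to the image of
  \<open>h\<close>, where the homomorphism laws turn it into an instance of an axiom of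
  \<open>'p\<close>.\<close>

lemma eq_iff_hom: "a = b \<longleftrightarrow> h a = h b"
  by (metis le_iff order_antisym order_refl)

lemmas hom = hom_bot hom_sup hom_mult hom_dom hom_cod

lemma dom_cod_prequantale_reflect:
  assumes "dom_cod_prequantale mult' one' dom' cod'"
  shows "dom_cod_prequantale mult one dom cod"
proof -
  interpret P: dom_cod_prequantale mult' one' dom' cod' by (fact assms)
  show ?thesis
  proof
    fix a b
    show "a \<le> dom a \<cdot> a"
      \<comment> \<open>Read from right to left, the laws \<open>hom\<close> gather the right-hand
        side into one value of \<open>h\<close>, which \<open>le_iff\<close> strips.\<close>
      using P.dom_absorb[of "h a"] by (simp flip: hom add: le_iff)
    show "a \<le> a \<cdot> cod a"
      using P.cod_absorb[of "h a"] by (simp flip: hom add: le_iff)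
    show "dom a \<le> one"
      using P.dom_le_one[of "h a"] by (simp flip: hom add: le_one)
    show "cod a \<le> one"
      using P.cod_le_one[of "h a"] by (simp flip: hom add: le_one)
  qed (simp_all add: eq_iff_hom hom P.dom_bot P.dom_sup P.cod_bot P.cod_sup P.dom_cod P.cod_dom)
qed

lemma modal_prequantale_reflect:
  assumes "modal_prequantale mult' one' dom' cod'"
  shows "modal_prequantale mult one dom cod"
proof -
  interpret P: modal_prequantale mult' one' dom' cod' by (fact assms)
  interpret dom_cod_prequantale mult one dom cod
    by (rule dom_cod_prequantale_reflect) unfold_locales
  show ?thesis
    by unfold_locales (simp_all add: eq_iff_hom hom P.dom_export P.cod_export)
qed

lemma weakly_local_modal_quantale_reflect:
  assumes "weakly_local_modal_quantale mult' one' dom' cod'"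
  shows "weakly_local_modal_quantale mult one dom cod"
proof -
  interpret P: weakly_local_modal_quantale mult' one' dom' cod' by (fact assms)
  interpret modal_prequantale mult one dom cod
    by (rule modal_prequantale_reflect) unfold_locales
  show ?thesis
    by unfold_locales (simp add: eq_iff_hom hom P.mult_assoc)
qed

lemma modal_quantale_reflect:
  assumes "modal_quantale mult' one' dom' cod'"
  shows "modal_quantale mult one dom cod"
proof -
  interpret P: modal_quantale mult' one' dom' cod' by (fact assms)
  interpret dom_cod_prequantale mult one dom cod
    by (rule dom_cod_prequantale_reflect) unfold_locales
  show ?thesis
    by unfold_locales (simp_all add: eq_iff_hom hom P.mult_assoc P.dom_local P.cod_local)
qed

end

definition point :: "'x \<Rightarrow> 'q::complete_lattice \<Rightarrow> 'x \<Rightarrow> 'q" where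
  "point e a = (\<lambda>x. if x = e then a else bot)"

text \<open>Serves both to compare two points and, with \<open>f\<close> the identity of the
  convolution, to bound a point by the unit.\<close>

lemma point_le_iff: "point e a \<le> f \<longleftrightarrow> a \<le> f e"
  by (auto simp: point_def le_fun_def)

text \<open>A term with \<open>y\<close> or \<open>z\<close> different from \<open>e\<close> has a
  factor \<open>bot\<close> and vanishes; the remaining term contributes only at members of
  \<open>m e e\<close>, that is, at \<open>e\<close>.\<close>

lemma (in prequantale) convolution_point:
  assumes "m e e = {e}"
  shows "convolution m mult (point e a) (point e b) = point e (a \<cdot> b)"
proof
  fix x
  have bot: "point e a y \<cdot> point e b z = bot" if "y \<noteq> e \<or> z \<noteq> e" for y z
    using that by (auto simp: point_def mult_bot_left mult_bot_right)
  show "convolution m mult (point e a) (point e b) x = point e (a \<cdot> b) x"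
    unfolding convolution_def
  proof (rule antisym)
    show "Sup {point e a y \<cdot> point e b z |y z. x \<in> m y z} \<le> point e (a \<cdot> b) x"
    proof (rule Sup_least, clarify)
      fix y z
      assume "x \<in> m y z"
      then show "point e a y \<cdot> point e b z \<le> point e (a \<cdot> b) x"
        using assms bot[of y z] by (cases "y = e \<and> z = e") (auto simp: point_def)
    qed
    show "point e (a \<cdot> b) x \<le> Sup {point e a y \<cdot> point e b z |y z. x \<in> m y z}"
    proof (cases "x = e")
      case True
      then show ?thesis
        using assms by (intro Sup_upper CollectI exI[of _ e]) (simp add: point_def)
    qed (simp add: point_def)
  qed
qed

text \<open>The fibre of \<open>k\<close> over \<open>e\<close> contains \<open>e\<close>, so the
  supremum runs over a singleton and not over the empty set.\<close>

lemma Dom_bot_fixed_point: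
  assumes "k e = e"
  shows "Dom k d bot e = d bot"
proof -
  have "{d (bot x) |x. k x = e} = {d bot}"
    using assms by auto
  then show ?thesis by (simp add: Dom_def)
qed

text \<open>Strictness of \<open>d\<close> removes every element of a fibre other than
  \<open>e\<close>, and \<open>k e = e\<close> keeps the surviving value at
  \<open>e\<close>.\<close>

lemma Dom_point:
  assumes "k e = e" and "d bot = bot"
  shows "Dom k d (point e a) = point e (d a)"
proof
  fix y
  show "Dom k d (point e a) y = point e (d a) y"
    unfolding Dom_def
  proof (rule antisym)
    show "Sup {d (point e a x) |x. k x = y} \<le> point e (d a) y"
      using assms by (auto intro!: Sup_least simp: point_def)
    show "point e (d a) y \<le> Sup {d (point e a x) |x. k x = y}"
    proof (cases "y = e")
      case True
      then show ?thesis
        using assms by (intro Sup_upper CollectI exI[of _ e]) (simp add: point_def)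
    qed (simp add: point_def)
  qed
qed

lemma Cod_eq_Dom: "Cod = Dom"
  by (intro ext) (simp add: Cod_def Dom_def)

lemma modal_embedding_point:
  fixes dom cod :: "'q::complete_lattice \<Rightarrow> 'q"
  assumes "prequantale mult one"
    and "m e e = {e}" and "l e = e" and "r e = e"
    and "dom bot = bot" and "cod bot = bot"
  shows "modal_embedding mult one dom cod
    (convolution m mult) (id_E l one) (Dom l dom) (Cod r cod) (point e)"
proof -
  interpret prequantale mult one by (fact assms)
  show ?thesis
  proof
    fix a b :: 'q
    show "point e a \<le> point e b \<longleftrightarrow> a \<le> b"
      unfolding point_le_iff by (simp add: point_def)
    show "point e a \<le> id_E l one \<Longrightarrow> a \<le> one"
      \<comment> \<open>Since \<open>l e = e\<close>, the value of \<open>id_E l one\<close> at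
        \<open>e\<close> is \<open>one\<close>.\<close>
      using assms by (simp add: point_le_iff id_E_def lr_units_def)
    show "point e bot = bot" "point e (sup a b) = sup (point e a) (point e b)"
      by (simp_all add: point_def fun_eq_iff)
    show "point e (mult a b) = convolution m mult (point e a) (point e b)"
      using assms(2) by (simp only: convolution_point)
    show "point e (dom a) = Dom l dom (point e a)"
      using assms(3,5) by (simp only: Dom_point)
    show "point e (cod a) = Cod r cod (point e a)"
      using assms(4,6) by (simp only: Cod_eq_Dom Dom_point)
  qed
qed

theorem theorem8p5:
  fixes m :: "'x \<Rightarrow> 'x \<Rightarrow> 'x set"
    and l r :: "'x \<Rightarrow> 'x"
    and mult :: "'q::complete_lattice \<Rightarrow> 'q \<Rightarrow> 'q"
    and one :: "'q"
    and dom cod :: "'q \<Rightarrow> 'q"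
  assumes "lr_multimagma m l r"
    and "\<exists>x y z w. m (l x) (l y) \<noteq> {} \<and> m z w \<noteq> {}"
    and "prequantale mult one"
    and "modal_prequantale (convolution m mult) (id_E l one) (Dom l dom) (Cod r cod)"
    and "id_E l one \<noteq> bot"
  shows "modal_prequantale mult one dom cod
    \<and> (lr_multisemigroup m l r
        \<and> weakly_local_modal_quantale (convolution m mult) (id_E l one) (Dom l dom) (Cod r cod)
        \<longrightarrow> weakly_local_modal_quantale mult one dom cod)
    \<and> (local_lr_multisemigroup m l r
        \<and> modal_quantale (convolution m mult) (id_E l one) (Dom l dom) (Cod r cod)
        \<longrightarrow> modal_quantale mult one dom cod)"
proof -
  interpret lr_multimagma m l r by (fact assms)
  interpret C: modal_prequantale "convolution m mult" "id_E l one" "Dom l dom" "Cod r cod"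
    by (fact assms)
  \<comment> \<open>Types are inhabited, so \<open>undefined\<close> stands for an arbitrary element
    of X.\<close>
  define e where "e = l undefined"
  have e: "m e e = {e}" "l e = e" "r e = e"
    by (simp_all add: e_def l_idem_mult l_l r_l)
  \<comment> \<open>Strictness comes before the embedding, because \<open>Dom_point\<close> relies
    on it. It is read off at \<open>e\<close> from strictness of \<open>Dom l dom\<close> and
    \<open>Cod r cod\<close>.\<close>
  have "dom bot = bot" "cod bot = bot"
    using Dom_bot_fixed_point[of l e dom] Dom_bot_fixed_point[of r e cod] C.dom_bot C.cod_bot e
    by (simp_all add: Cod_eq_Dom)
  then interpret modal_embedding mult one dom cod
      "convolution m mult" "id_E l one" "Dom l dom" "Cod r cod" "point e"
    using assms(3) e by (intro modal_embedding_point)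
  show ?thesis
    using assms(4) modal_prequantale_reflect weakly_local_modal_quantale_reflect
      modal_quantale_reflect by blast
qed

end
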